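(* Let $\mathbb{M}$ be a PNL-model, $\mathsf{a}$ an agent of $\mathbb{M}$, and $\phi$ a PNL formula. Then: (1) Player I has a winning strategy for the semantic game $\mathbf{G}_{\mathbb{M}}(\mathbf{P},\mathsf{a}:\phi)$ if and only if $\mathbb{M},\mathsf{a}\Vdash\phi$. (2) Player You has a winning strategy for $\mathbf{G}_{\mathbb{M}}(\mathbf{P},\mathsf{a}:\phi)$ if and only if $\mathbb{M},\mathsf{a}\not\Vdash\phi$.
   Context: Language. Fix a countable set $\mathrm{At}$ of propositional variables and a countable set $N$ of nominals. PNL formulas are generated by $\phi ::= p \mid R^+(i,j)\mid R^-(i,j)\mid \neg\phi\mid\phi\wedge\phi\mid\phi\vee\phi\mid\Diamond^+\phi\mid\Diamond^-\phi\mid[A]\phi$ with $p\in\mathrm{At}$, $i,j\in N$. Formulas $p$, $R^+(i,j)$, $R^-(i,j)$ are called elementary. The superscript $\pm$ stands for either $+$ or $-$ (uniformly). Models. A model is $\mathbb{M}=\langle\mathsf{A},\mathsf{R}^+,\mathsf{R}^-,\mathsf{V},\mathsf{g}\rangle$ with $\mathsf{A}$ a non-empty set (of agents), $\mathsf{g}:N\to\mathsf{A}$, $\mathsf{R}^+,\mathsf{R}^-\subseteq\mathsf{A}\times\mathsf{A}$, $\mathsf{V}:\mathrm{At}\to\mathcal{P}(\mathsf{A})$. It is a PNL-model if $\mathsf{R}^+$ is reflexive, $\mathsf{R}^+$ and $\mathsf{R}^-$ are symmetric, and $\mathsf{R}^+\cap\mathsf{R}^-=\emptyset$. Kripke semantics.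 $\mathbb{M},\mathsf{a}\Vdash p$ iff $\mathsf{a}\in\mathsf{V}(p)$; $\mathbb{M},\mathsf{a}\Vdash R^\pm(i,j)$ iff $(\mathsf{g}(i),\mathsf{g}(j))\in\mathsf{R}^\pm$; $\neg,\wedge,\vee$ as usual; $\mathbb{M},\mathsf{a}\Vdash\Diamond^\pm\phi$ iff there is $\mathsf{b}$ with $(\mathsf{a},\mathsf{b})\in\mathsf{R}^\pm$ and $\mathbb{M},\mathsf{b}\Vdash\phi$; $\mathbb{M},\mathsf{a}\Vdash[A]\phi$ iff $\mathbb{M},\mathsf{b}\Vdash\phi$ for all $\mathsf{b}\in\mathsf{A}$. Semantic game. It is played by two players, I and You. Game states are $\mathbf{P},\mathsf{a}:\phi$ (I am the proponent) and $\mathbf{O},\mathsf{a}:\phi$ (I am the opponent). $\mathbf{G}_{\mathbb{M}}(g)$ is the game over $\mathbb{M}$ starting at state $g$, with the following rules. - At $\mathbf{P},\mathsf{a}:\phi_1\wedge\phi_2$, You choose $k\in\{1,2\}$ and the game continues with $\mathbf{P},\mathsf{a}:\phi_k$. At $\mathbf{O},\mathsf{a}:\phi_1\wedge\phi_2$, I choose $k$ and the game continues with $\mathbf{O},\mathsf{a}:\phi_k$. - At $\mathbf{P},\mathsf{a}:\phi_1\vee\phi_2$, I choose $k$ and the game continues with $\mathbf{P},\mathsf{a}:\phi_k$. At $\mathbf{O},\mathsf{a}:\phi_1\vee\phi_2$, You choose $k$ and the game continues with $\mathbf{O},\mathsf{a}:\phi_k$. - $\mathbf{P},\mathsf{a}:\neg\phi$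 continues with $\mathbf{O},\mathsf{a}:\phi$; $\mathbf{O},\mathsf{a}:\neg\phi$ continues with $\mathbf{P},\mathsf{a}:\phi$. - At $\mathbf{P},\mathsf{a}:\Diamond^\pm\phi$, You win if $\mathsf{a}$ has no $\mathsf{R}^\pm$-successor; otherwise I choose an $\mathsf{R}^\pm$-successor $\mathsf{b}$ of $\mathsf{a}$ and the game continues with $\mathbf{P},\mathsf{b}:\phi$. At $\mathbf{O},\mathsf{a}:\Diamond^\pm\phi$, I win if $\mathsf{a}$ has no $\mathsf{R}^\pm$-successor; otherwise You choose an $\mathsf{R}^\pm$-successor $\mathsf{b}$ and the game continues with $\mathbf{O},\mathsf{b}:\phi$. - At $\mathbf{P},\mathsf{a}:[A]\phi$, You choose an agent $\mathsf{b}$ and the game continues with $\mathbf{P},\mathsf{b}:\phi$. At $\mathbf{O},\mathsf{a}:[A]\phi$, I choose an agent $\mathsf{b}$ and the game continues with $\mathbf{O},\mathsf{b}:\phi$. - For elementary $\phi_e$: at $\mathbf{P},\mathsf{a}:\phi_e$, I win if $\mathbb{M},\mathsf{a}\Vdash\phi_e$ and otherwise You win; at $\mathbf{O},\mathsf{a}:\phi_e$, I win if $\mathbb{M},\mathsf{a}\not\Vdash\phi_e$ and otherwise You win. The game tree has root $g$; children of a node are the states reachable by one legal choice; each node is labeled by the player to move (negation nodes are labeled I), and leaves by the winner. A strategy for I is a subtree containing the root, containing all children of every contained node labeled You, and exactly one child of every contained (non-leaf) node labeled I; it is winning if all its leaves are won by I. (Winning) strategies for You are defined dually. *)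

theory Defs
  imports "HOL-Library.Countable"
begin

datatype sign = Plus | Minus

datatype ('p, 'n) fm =
    Atom 'p
  | Rel sign 'n 'n
  | Neg "('p, 'n) fm"
  | And "('p, 'n) fm" "('p, 'n) fm"
  | Or "('p, 'n) fm" "('p, 'n) fm"
  | Dia sign "('p, 'n) fm"
  | Univ "('p, 'n) fm"

record ('a, 'p, 'n) model =
  agents :: "'a set"
  rel :: "sign \<Rightarrow> ('a \<times> 'a) set"
  val :: "'p \<Rightarrow> 'a set"
  nom :: "'n \<Rightarrow> 'a"

definition is_model :: "('a, 'p, 'n) model \<Rightarrow> bool" where
  "is_model M \<longleftrightarrow>
     agents M \<noteq> {} \<and>
     (\<forall>s. rel M s \<subseteq> agents M \<times> agents M) \<and>
     (\<forall>p. val M p \<subseteq> agents M) \<and>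
     (\<forall>i. nom M i \<in> agents M)"

definition PNL_model :: "('a, 'p, 'n) model \<Rightarrow> bool" where
  "PNL_model M \<longleftrightarrow>
     is_model M \<and>
     refl_on (agents M) (rel M Plus) \<and>
     sym (rel M Plus) \<and> sym (rel M Minus) \<and>
     rel M Plus \<inter> rel M Minus = {}"

primrec sat :: "('a, 'p, 'n) model \<Rightarrow> 'a \<Rightarrow> ('p, 'n) fm \<Rightarrow> bool" where
  "sat M a (Atom p) \<longleftrightarrow> a \<in> val M p"
| "sat M a (Rel s i j) \<longleftrightarrow> (nom M i, nom M j) \<in> rel M s"
| "sat M a (Neg \<phi>) \<longleftrightarrow> \<not> sat M a \<phi>"
| "sat M a (And \<phi> \<psi>) \<longleftrightarrow> sat M a \<phi> \<and> sat M a \<psi>"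
| "sat M a (Or \<phi> \<psi>) \<longleftrightarrow> sat M a \<phi> \<or> sat M a \<psi>"
| "sat M a (Dia s \<phi>) \<longleftrightarrow> (\<exists>b. (a, b) \<in> rel M s \<and> sat M b \<phi>)"
| "sat M a (Univ \<phi>) \<longleftrightarrow> (\<forall>b\<in>agents M. sat M b \<phi>)"

datatype player = Me | You

text \<open>The constructor of a state gives the role of \<^const>\<open>Me\<close>.\<close>

datatype ('a, 'p, 'n) state =
    Proponent 'a "('p, 'n) fm"
  | Opponent 'a "('p, 'n) fm"

fun moves :: "('a, 'p, 'n) model \<Rightarrow> ('a, 'p, 'n) state \<Rightarrow> ('a, 'p, 'n) state set" where
  "moves M (Proponent a (Atom p)) = {}"
| "moves M (Opponent a (Atom p)) = {}"
| "moves M (Proponent a (Rel s i j)) = {}"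
| "moves M (Opponent a (Rel s i j)) = {}"
| "moves M (Proponent a (Neg \<phi>)) = {Opponent a \<phi>}"
| "moves M (Opponent a (Neg \<phi>)) = {Proponent a \<phi>}"
| "moves M (Proponent a (And \<phi> \<psi>)) = {Proponent a \<phi>, Proponent a \<psi>}"
| "moves M (Opponent a (And \<phi> \<psi>)) = {Opponent a \<phi>, Opponent a \<psi>}"
| "moves M (Proponent a (Or \<phi> \<psi>)) = {Proponent a \<phi>, Proponent a \<psi>}"
| "moves M (Opponent a (Or \<phi> \<psi>)) = {Opponent a \<phi>, Opponent a \<psi>}"
| "moves M (Proponent a (Dia s \<phi>)) = {Proponent b \<phi> | b. (a, b) \<in> rel M s}"
| "moves M (Opponent a (Dia s \<phi>)) = {Opponent b \<phi> | b. (a, b) \<in> rel M s}"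
| "moves M (Proponent a (Univ \<phi>)) = {Proponent b \<phi> | b. b \<in> agents M}"
| "moves M (Opponent a (Univ \<phi>)) = {Opponent b \<phi> | b. b \<in> agents M}"

text \<open>
  The label of a state is the winner if no move is possible, and the player to move otherwise.
  The first case arises for elementary formulas and for diamonds without successors.
\<close>

fun label :: "('a, 'p, 'n) model \<Rightarrow> ('a, 'p, 'n) state \<Rightarrow> player" where
  "label M (Proponent a (Atom p)) = (if sat M a (Atom p) then Me else You)"
| "label M (Opponent a (Atom p)) = (if \<not> sat M a (Atom p) then Me else You)"
| "label M (Proponent a (Rel s i j)) = (if sat M a (Rel s i j) then Me else You)"
| "label M (Opponent a (Rel s i j)) = (if \<not> sat M a (Rel s i j) then Me else You)"
| "label M (Proponent a (Neg \<phi>)) = Me"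
| "label M (Opponent a (Neg \<phi>)) = Me"
| "label M (Proponent a (And \<phi> \<psi>)) = You"
| "label M (Opponent a (And \<phi> \<psi>)) = Me"
| "label M (Proponent a (Or \<phi> \<psi>)) = Me"
| "label M (Opponent a (Or \<phi> \<psi>)) = You"
| "label M (Proponent a (Dia s \<phi>)) = (if \<nexists>b. (a, b) \<in> rel M s then You else Me)"
| "label M (Opponent a (Dia s \<phi>)) = (if \<nexists>b. (a, b) \<in> rel M s then Me else You)"
| "label M (Proponent a (Univ \<phi>)) = You"
| "label M (Opponent a (Univ \<phi>)) = Me"

text \<open>
  The same state can occur at several places of the game tree, so a node is represented by the
  nonempty list of states on the path from the root to it; the state at a node is the last
  element of that list.
\<close>

definition children ::
  "('a, 'p, 'n) model \<Rightarrow> ('a, 'p, 'n) state list \<Rightarrow> ('a, 'p, 'n) state list set" where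
  "children M h = {h @ [t] | t. t \<in> moves M (last h)}"

inductive_set game_tree ::
  "('a, 'p, 'n) model \<Rightarrow> ('a, 'p, 'n) state \<Rightarrow> ('a, 'p, 'n) state list set"
  for M g where
  root: "[g] \<in> game_tree M g"
| child: "h \<in> game_tree M g \<Longrightarrow> h' \<in> children M h \<Longrightarrow> h' \<in> game_tree M g"

text \<open>
  The third conjunct, closure under parents, makes \<open>S\<close> a subtree rather than just a set of nodes.
\<close>

definition strategy ::
  "('a, 'p, 'n) model \<Rightarrow> ('a, 'p, 'n) state \<Rightarrow> player \<Rightarrow> ('a, 'p, 'n) state list set \<Rightarrow> bool" where
  "strategy M g X S \<longleftrightarrow>
     S \<subseteq> game_tree M g \<and>
     [g] \<in> S \<and>
     (\<forall>h\<in>game_tree M g. \<forall>h'\<in>children M h. h' \<in> S \<longrightarrow> h \<in> S) \<and>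
     (\<forall>h\<in>S. label M (last h) \<noteq> X \<longrightarrow> children M h \<subseteq> S) \<and>
     (\<forall>h\<in>S. label M (last h) = X \<and> children M h \<noteq> {} \<longrightarrow> (\<exists>!h'. h' \<in> children M h \<and> h' \<in> S))"

definition winning_strategy ::
  "('a, 'p, 'n) model \<Rightarrow> ('a, 'p, 'n) state \<Rightarrow> player \<Rightarrow> ('a, 'p, 'n) state list set \<Rightarrow> bool" where
  "winning_strategy M g X S \<longleftrightarrow>
     strategy M g X S \<and>
     (\<forall>h\<in>S. children M h \<inter> S = {} \<longrightarrow> label M (last h) = X)"

end

theory Submission imports Defs begin

text \<open>
  Truth of the formula in a state determines which player ought to win it. This assignment
  satisfies the backward induction equations of the game: the player to move ought to win exactly
  if some move leads to a state that they ought to win. Always moving to such a state is a winning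
  strategy; conversely, induction on the size of the formula shows that every node of a winning
  strategy ought to be won by its owner.
\<close>

primrec winner :: "('a, 'p, 'n) model \<Rightarrow> ('a, 'p, 'n) state \<Rightarrow> player" where
  "winner M (Proponent a \<phi>) = (if sat M a \<phi> then Me else You)"
| "winner M (Opponent a \<phi>) = (if sat M a \<phi> then You else Me)"

primrec state_fm :: "('a, 'p, 'n) state \<Rightarrow> ('p, 'n) fm" where
  "state_fm (Proponent a \<phi>) = \<phi>"
| "state_fm (Opponent a \<phi>) = \<phi>"

text \<open>Every move passes to an immediate subformula. This supplies the measure for the
  induction along the nodes of a winning strategy.\<close>

lemma moves_decrease_size:
  assumes "t \<in> moves M s"
  shows "size (state_fm t) < size (state_fm s)"
  using assms by (cases "(M, s)" rule: moves.cases) auto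

text \<open>Nonemptiness of \<open>agents M\<close> rules out leaves at \<open>Univ\<close>: over an
  empty domain such a formula would be vacuously true, while \<open>label\<close> gives the
  proponent's state to \<open>You\<close>.\<close>

lemma winner_leaf:
  assumes "agents M \<noteq> {}" and "moves M s = {}"
  shows "winner M s = label M s"
  using assms by (cases "(M, s)" rule: moves.cases) auto

text \<open>The clauses of \<open>sat\<close> match those of \<open>label\<close>: a player moves
  where their own goal is existential or disjunctive. Negation has a single move, which swaps both
  role and truth value.\<close>

lemma winner_eq_label_iff:
  assumes "moves M s \<noteq> {}"
  shows "winner M s = label M s \<longleftrightarrow> (\<exists>t\<in>moves M s. winner M t = label M s)"
  using assms by (cases "(M, s)" rule: moves.cases) (auto split: if_splits)

lemma winner_neq_label_iff:
  assumes "label M s \<noteq> X" and "moves M s \<noteq> {}"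
  shows "winner M s = X \<longleftrightarrow> (\<forall>t\<in>moves M s. winner M t = X)"
proof -
  \<comment> \<open>There are only two players, so the claim is the negation of
    \<open>winner_eq_label_iff\<close> on both sides.\<close>
  have "u = X \<longleftrightarrow> u \<noteq> label M s" for u
    using assms(1) by (cases u; cases X; cases "label M s") auto
  then show ?thesis using winner_eq_label_iff[OF assms(2)] by auto
qed

lemma game_tree_nonempty: "h \<in> game_tree M g \<Longrightarrow> h \<noteq> []"
  by (induction rule: game_tree.induct) (auto simp: children_def)

lemma children_empty_iff: "children M h = {} \<longleftrightarrow> moves M (last h) = {}"
  by (auto simp: children_def)

text \<open>The plays in which \<open>X\<close> follows \<open>f\<close> and the other player moves
  freely. The choice depends on the current state alone, although nodes record the whole
  history.\<close>

inductive_set positional_strategy ::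
  "('a, 'p, 'n) model \<Rightarrow> ('a, 'p, 'n) state \<Rightarrow> player \<Rightarrow>
   (('a, 'p, 'n) state \<Rightarrow> ('a, 'p, 'n) state) \<Rightarrow> ('a, 'p, 'n) state list set"
  for M g X f where
  root: "[g] \<in> positional_strategy M g X f"
| child: "\<lbrakk>h \<in> positional_strategy M g X f; t \<in> moves M (last h);
    label M (last h) = X \<Longrightarrow> t = f (last h)\<rbrakk> \<Longrightarrow> h @ [t] \<in> positional_strategy M g X f"

lemma positional_strategy_subset_game_tree: "positional_strategy M g X f \<subseteq> game_tree M g"
proof
  fix h assume "h \<in> positional_strategy M g X f"
  then show "h \<in> game_tree M g"
    by induction (auto intro: game_tree.intros simp: children_def)
qed

text \<open>Nonemptiness of \<open>h\<close> separates the two rules, since the root is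
  \<open>[] @ [g]\<close>.\<close>

lemma positional_strategy_snoc_iff:
  assumes "h \<noteq> []"
  shows "h @ [t] \<in> positional_strategy M g X f \<longleftrightarrow>
    h \<in> positional_strategy M g X f \<and> t \<in> moves M (last h) \<and>
    (label M (last h) = X \<longrightarrow> t = f (last h))"
  using assms
  by (subst positional_strategy.simps) (auto simp: append_eq_Cons_conv)

text \<open>Legality of \<open>f\<close> is demanded only at nodes that are reached, because the
  choice function used below is meaningful only at states that \<open>X\<close> ought to
  win.\<close>

lemma strategy_positional_strategy:
  assumes "\<And>h. \<lbrakk>h \<in> positional_strategy M g X f; label M (last h) = X; moves M (last h) \<noteq> {}\<rbrakk>
    \<Longrightarrow> f (last h) \<in> moves M (last h)"
  shows "strategy M g X (positional_strategy M g X f)"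
proof -
  note tree = positional_strategy_subset_game_tree[of M g X f]
  have nonempty: "h \<noteq> []" if "h \<in> positional_strategy M g X f" for h
    using that tree game_tree_nonempty by blast
  have "\<exists>!h'. h' \<in> children M h \<and> h' \<in> positional_strategy M g X f"
    if "h \<in> positional_strategy M g X f" "label M (last h) = X" "children M h \<noteq> {}" for h
    using that assms[of h] nonempty[of h]
    by (intro ex1I[of _ "h @ [f (last h)]"])
      (auto simp: children_def positional_strategy_snoc_iff)
  moreover have "h \<in> positional_strategy M g X f"
    if "h \<in> game_tree M g" "h' \<in> children M h" "h' \<in> positional_strategy M g X f" for h h'
    using that game_tree_nonempty[OF that(1)]
    by (auto simp: children_def positional_strategy_snoc_iff)
  moreover have "children M h \<subseteq> positional_strategy M g X f"
    if "h \<in> positional_strategy M g X f" "label M (last h) \<noteq> X" for h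
    using that nonempty[OF that(1)] by (auto simp: children_def positional_strategy_snoc_iff)
  ultimately show ?thesis
    unfolding strategy_def by (intro conjI ballI impI tree positional_strategy.root) simp_all
qed

lemma exists_winning_strategy:
  assumes agents: "agents M \<noteq> {}" and winner: "winner M g = X"
  shows "\<exists>S. winning_strategy M g X S"
proof -
  \<comment> \<open>Where no such move exists, \<open>SOME\<close> returns an arbitrary state; the
    invariant \<open>keep\<close> ensures that play never follows that value.\<close>
  define f where "f s = (SOME t. t \<in> moves M s \<and> winner M t = X)" for s
  have f: "f s \<in> moves M s \<and> winner M (f s) = X"
    if "winner M s = X" "label M s = X" "moves M s \<noteq> {}" for s
    unfolding f_def by (rule someI_ex) (use that winner_eq_label_iff[of M s] in auto)
  let ?S = "positional_strategy M g X f"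
  have keep: "winner M (last h) = X" if "h \<in> ?S" for h
    using that
  proof induction
    case (child h t)
    show ?case
    proof (cases "label M (last h) = X")
      case True
      then show ?thesis using child f[of "last h"] by auto
    next
      case False
      then show ?thesis
        using child winner_neq_label_iff[of M "last h" X] by auto
    qed
  qed (simp add: winner)
  have strat: "strategy M g X ?S"
    by (rule strategy_positional_strategy) (use f keep in blast)
  moreover have "label M (last h) = X" if h: "h \<in> ?S" "children M h \<inter> ?S = {}" for h
  \<comment> \<open>If the other player owned this leaf of the subtree, all its children would lie
    in the subtree, so it would be a leaf of the game; there \<open>winner\<close> and
    \<open>label\<close> agree, against \<open>keep\<close>.\<close>
  proof (rule ccontr)
    assume other: "label M (last h) \<noteq> X"
    then have "children M h \<subseteq> ?S" using strat h(1) unfolding strategy_def by blast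
    then have "moves M (last h) = {}" using h(2) by (auto simp: children_empty_iff[symmetric])
    then show False using winner_leaf[OF agents] keep[OF h(1)] other by metis
  qed
  ultimately show ?thesis unfolding winning_strategy_def by blast
qed

text \<open>Stated for all nodes of \<open>S\<close>, not just the root, so that the induction
  hypothesis applies to the children that \<open>S\<close> retains: one where \<open>X\<close>
  moves, all of them elsewhere.\<close>

lemma winner_of_winning_strategy_node:
  assumes agents: "agents M \<noteq> {}" and win: "winning_strategy M g X S" and "h \<in> S"
  shows "winner M (last h) = X"
  using \<open>h \<in> S\<close>
proof (induction "size (state_fm (last h))" arbitrary: h rule: less_induct)
  case less
  have strat: "strategy M g X S" using win by (simp add: winning_strategy_def)
  have IH: "winner M t = X" if "h @ [t] \<in> S" "t \<in> moves M (last h)" for t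
    using less.hyps[of "h @ [t]"] that moves_decrease_size[of t M "last h"] by simp
  show ?case
  proof (cases "moves M (last h) = {}")
    case True
    then have "label M (last h) = X"
      using win less.prems by (simp add: winning_strategy_def children_empty_iff[symmetric])
    then show ?thesis using winner_leaf[OF agents True] by simp
  next
    case False
    show ?thesis
    proof (cases "label M (last h) = X")
      case True
      then obtain h' where "h' \<in> children M h" "h' \<in> S"
        using strat less.prems False unfolding strategy_def children_empty_iff[symmetric] by blast
      then obtain t where "t \<in> moves M (last h)" "h @ [t] \<in> S"
        by (auto simp: children_def)
      then show ?thesis using IH[of t] winner_eq_label_iff[OF False] True by auto
    next
      case other: False
      then have "children M h \<subseteq> S"
        using strat less.prems unfolding strategy_def by blast
      then have "\<forall>t\<in>moves M (last h). winner M t = X"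
        using IH by (auto simp: children_def)
      then show ?thesis
        using winner_neq_label_iff[OF other False] by blast
    qed
  qed
qed

lemma winning_strategy_iff_winner:
  assumes "agents M \<noteq> {}"
  shows "(\<exists>S. winning_strategy M g X S) \<longleftrightarrow> winner M g = X"
proof
  assume "\<exists>S. winning_strategy M g X S"
  then obtain S where S: "winning_strategy M g X S" ..
  then have "[g] \<in> S" unfolding winning_strategy_def strategy_def by blast
  then show "winner M g = X" using winner_of_winning_strategy_node[OF assms S] by fastforce
qed (rule exists_winning_strategy[OF assms])

theorem theorem1:
  fixes M :: "('a, 'p::countable, 'n::countable) model"
    and a :: 'a
    and \<phi> :: "('p, 'n) fm"
  assumes "PNL_model M"
    and "a \<in> agents M"
  shows "((\<exists>S. winning_strategy M (Proponent a \<phi>) Me S) \<longleftrightarrow> sat M a \<phi>) \<and>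
         ((\<exists>S. winning_strategy M (Proponent a \<phi>) You S) \<longleftrightarrow> \<not> sat M a \<phi>)"
proof -
  \<comment> \<open>The player is arbitrary in \<open>winning_strategy_iff_winner\<close>, so its
    instances \<open>Me\<close> and \<open>You\<close> give the two equivalences once
    \<open>winner\<close> is unfolded at the proponent's state.\<close>
  have "agents M \<noteq> {}" using assms(2) by blast
  then show ?thesis by (simp add: winning_strategy_iff_winner)
qed

end
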